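(* Let $P\in\mathbb{H}[X]$ be a polynomial of degree $d\ge 3$. Suppose that $N(P)(X)=X^{2e}\cdot(X^2+1)^{d-e}$ for some integer $e$ with $0\le e<d$, and that $N(P')(X)=\sum_{k=0}^{2d-2}X^k b_k$ contains a unique monomial of odd degree, that is, $b_k\ne 0$ for a unique odd $k$. Then $P$ is not a Gauss-Lucas polynomial.
   Context: $\mathbb{H}$ denotes the real algebra of quaternions. $\mathbb{H}[X]$ is the ring of quaternionic polynomials $P(X)=\sum_{k=0}^d X^k a_k$ with coefficients $a_k\in\mathbb{H}$ written on the right; the product $P\cdot Q$ is defined by letting $X$ commute with the coefficients, i.e. $(\sum_h X^h a_h)\cdot(\sum_k X^k b_k)=\sum_{h,k}X^{h+k}a_hb_k$. The value of $P$ at $x\in\mathbb{H}$ is $P(x)=\sum_{k=0}^d x^k a_k$, and $V(P)=\{x\in\mathbb{H}\mid P(x)=0\}$. The derivative is $P'(X)=\sum_{k=1}^d X^{k-1}k a_k$. Set $P^c(X)=\sum_{k=0}^d X^k\bar a_k$ (quaternionic conjugates of the coefficients) and $N(P)=P\cdot P^c=P^c\cdot P$, the normal polynomial of $P$, which has real coefficients. Let $\mathcal{K}(N(P))$ denote the convex hull in $\mathbb{H}\cong\mathbb{R}^4$ of $V(N(P))\subset\mathbb{H}$. A polynomial $P\in\mathbb{H}[X]$ of degree $\ge 2$ is called a Gauss-Lucas polynomial if $V(P')\subset\mathcal{K}(N(P))$. *)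

theory Defs
  imports "HOL-Analysis.Analysis" "HOL-Library.Poly_Mapping"
begin

section \<open>Quaternions\<close>

text \<open>\<open>Quat a b c d\<close> is the quaternion \<open>a + b i + c j + d k\<close>.\<close>

datatype quat = Quat (qre: real) (qi: real) (qj: real) (qk: real)

lemma quat_eq_iff:
  "x = y \<longleftrightarrow> qre x = qre y \<and> qi x = qi y \<and> qj x = qj y \<and> qk x = qk y"
  by (cases x; cases y) auto

instantiation quat :: real_algebra_1
begin

definition zero_quat where "0 = Quat 0 0 0 0"

definition one_quat where "1 = Quat 1 0 0 0"

definition plus_quat where
  "x + y = Quat (qre x + qre y) (qi x + qi y) (qj x + qj y) (qk x + qk y)"

definition uminus_quat where
  "- x = Quat (- qre x) (- qi x) (- qj x) (- qk x)"

definition minus_quat where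
  "x - y = Quat (qre x - qre y) (qi x - qi y) (qj x - qj y) (qk x - qk y)"

definition times_quat where
  "x * y = Quat
     (qre x * qre y - qi x * qi y - qj x * qj y - qk x * qk y)
     (qre x * qi y + qi x * qre y + qj x * qk y - qk x * qj y)
     (qre x * qj y - qi x * qk y + qj x * qre y + qk x * qi y)
     (qre x * qk y + qi x * qj y - qj x * qi y + qk x * qre y)"

definition scaleR_quat where
  "r *\<^sub>R x = Quat (r * qre x) (r * qi x) (r * qj x) (r * qk x)"

instance
  by standard
    (auto simp: quat_eq_iff zero_quat_def one_quat_def plus_quat_def uminus_quat_def
      minus_quat_def times_quat_def scaleR_quat_def algebra_simps)

end

definition qcnj :: "quat \<Rightarrow> quat" where
  "qcnj x = Quat (qre x) (- qi x) (- qj x) (- qk x)"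


section \<open>Quaternionic polynomials\<close>

text \<open>
  The product of finitely supported functions from \<^typ>\<open>nat\<close> is the convolution product, which
  needs no commutativity of the coefficients; the indeterminate is central. (The type of
  univariate polynomials of \<open>HOL-Computational_Algebra\<close> has a product only over commutative
  semirings.)  The coefficient of \<open>X ^ k\<close> in \<open>P\<close> is \<open>Poly_Mapping.lookup P k\<close>.
\<close>

type_synonym hpoly = "nat \<Rightarrow>\<^sub>0 quat"

definition hX :: hpoly where
  "hX = Poly_Mapping.single 1 1"

text \<open>\<open>Poly_Mapping.degree\<close> is one more than the usual degree of a nonzero polynomial.\<close>

definition hdegree :: "hpoly \<Rightarrow> nat" where
  "hdegree P = (if P = 0 then 0 else Max (Poly_Mapping.keys P))"

definition heval :: "hpoly \<Rightarrow> quat \<Rightarrow> quat" where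
  "heval P x = (\<Sum>k\<le>hdegree P. x ^ k * Poly_Mapping.lookup P k)"

definition hzeros :: "hpoly \<Rightarrow> quat set" where
  "hzeros P = {x. heval P x = 0}"

definition hderiv :: "hpoly \<Rightarrow> hpoly" where
  "hderiv P =
     (\<Sum>k = 1..hdegree P. Poly_Mapping.single (k - 1) (of_nat k * Poly_Mapping.lookup P k))"

definition hcnj :: "hpoly \<Rightarrow> hpoly" where
  "hcnj P = Poly_Mapping.map qcnj P"

definition hnormal :: "hpoly \<Rightarrow> hpoly" where
  "hnormal P = P * hcnj P"

definition gauss_lucas :: "hpoly \<Rightarrow> bool" where
  "gauss_lucas P \<longleftrightarrow>
     hdegree P \<ge> 2 \<and> hzeros (hderiv P) \<subseteq> convex hull (hzeros (hnormal P))"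

end

(*
  A nonzero odd power b X^k that is the only odd term of f = N(P') makes the imaginary part of
  f(iy) equal to (+/-) b y^k, so the only purely imaginary root of f is 0. If P were Gauss-Lucas,
  all zeros of P' would have real part 0, and hence so would all complex roots of f, as every
  complex root of N(Q) shares its real part with a quaternionic zero of Q. So f would be c X^k,
  which is impossible for odd k because f is nonnegative on the real line.
*)
theory Submission
  imports Defs "HOL-Computational_Algebra.Fundamental_Theorem_Algebra"
begin

section \<open>Quaternions\<close>

lemma quat_sel [simp]:
  "qre 0 = 0" "qi 0 = 0" "qj 0 = 0" "qk 0 = 0"
  "qre 1 = 1" "qi 1 = 0" "qj 1 = 0" "qk 1 = 0"
  "qre (x + y) = qre x + qre y" "qi (x + y) = qi x + qi y"
  "qj (x + y) = qj x + qj y" "qk (x + y) = qk x + qk y"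
  "qre (- x) = - qre x" "qi (- x) = - qi x" "qj (- x) = - qj x" "qk (- x) = - qk x"
  "qre (x * y) = qre x * qre y - qi x * qi y - qj x * qj y - qk x * qk y"
  "qi (x * y) = qre x * qi y + qi x * qre y + qj x * qk y - qk x * qj y"
  "qj (x * y) = qre x * qj y - qi x * qk y + qj x * qre y + qk x * qi y"
  "qk (x * y) = qre x * qk y + qi x * qj y - qj x * qi y + qk x * qre y"
  "qre (r *\<^sub>R x) = r * qre x" "qi (r *\<^sub>R x) = r * qi x"
  "qj (r *\<^sub>R x) = r * qj x" "qk (r *\<^sub>R x) = r * qk x"
  "qre (qcnj x) = qre x" "qi (qcnj x) = - qi x" "qj (qcnj x) = - qj x" "qk (qcnj x) = - qk x"
  by (simp_all add: zero_quat_def one_quat_def plus_quat_def uminus_quat_def times_quat_def scaleR_quat_def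
      qcnj_def)

lemma quat_sel_sum [simp]:
  "qre (sum f A) = (\<Sum>a\<in>A. qre (f a))" "qi (sum f A) = (\<Sum>a\<in>A. qi (f a))"
  "qj (sum f A) = (\<Sum>a\<in>A. qj (f a))" "qk (sum f A) = (\<Sum>a\<in>A. qk (f a))"
  by (induction A rule: infinite_finite_induct; simp)+

lemma qcnj_0 [simp]: "qcnj 0 = 0"
  by (simp add: quat_eq_iff)

lemma qcnj_mult: "qcnj (x * y) = qcnj y * qcnj x"
  by (simp add: quat_eq_iff algebra_simps)

lemma qcnj_qcnj [simp]: "qcnj (qcnj x) = x"
  by (simp add: quat_eq_iff)

lemma qcnj_sum: "qcnj (sum f A) = (\<Sum>a\<in>A. qcnj (f a))"
  by (simp add: quat_eq_iff sum_negf)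

section \<open>The squared norm and the absence of zero divisors\<close>

definition qsqnorm :: "quat \<Rightarrow> real" where
  "qsqnorm x = (qre x)\<^sup>2 + (qi x)\<^sup>2 + (qj x)\<^sup>2 + (qk x)\<^sup>2"

lemma qsqnorm_eq_0_iff [simp]: "qsqnorm x = 0 \<longleftrightarrow> x = 0"
  by (simp add: qsqnorm_def quat_eq_iff add_nonneg_eq_0_iff)

lemma qsqnorm_mult: "qsqnorm (x * y) = qsqnorm x * qsqnorm y"
  by (simp add: qsqnorm_def power2_eq_square algebra_simps)

lemma qsqnorm_scaleR: "qsqnorm (r *\<^sub>R x) = r\<^sup>2 * qsqnorm x"
  by (simp add: qsqnorm_def power_mult_distrib algebra_simps)

lemma qsqnorm_qcnj [simp]: "qsqnorm (qcnj x) = qsqnorm x"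
  by (simp add: qsqnorm_def)

lemma qcnj_mult_self: "qcnj x * x = qsqnorm x *\<^sub>R 1"
  by (simp add: quat_eq_iff qsqnorm_def power2_eq_square)

instance quat :: ring_no_zero_divisors
proof
  fix x y :: quat
  assume "x \<noteq> 0" "y \<noteq> 0"
  then have "qsqnorm (x * y) \<noteq> 0"
    by (simp add: qsqnorm_mult)
  then show "x * y \<noteq> 0"
    by simp
qed

instance quat :: ring_1_no_zero_divisors ..

lemma quat_sq_plus_1_eq_0:
  fixes x :: quat
  assumes "x\<^sup>2 + 1 = 0"
  shows "qre x = 0"
proof (rule ccontr)
  assume ne: "qre x \<noteq> 0"
  have eqs: "qre x * qre x - qi x * qi x - qj x * qj x - qk x * qk x + 1 = 0"
    "qre x * qi x = 0" "qre x * qj x = 0" "qre x * qk x = 0"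
    using assms by (simp_all add: power2_eq_square quat_eq_iff algebra_simps)
  \<comment> \<open>A nonzero real part cancels from the mixed equations, so all imaginary
    components vanish and x would be real.\<close>
  then have "qre x * qre x + 1 = 0"
    using ne by simp
  then show False
    using zero_le_square[of "qre x"] by linarith
qed

lemma quat_imaginary_unit_sq:
  assumes "qre u = 0" and "qsqnorm u = 1"
  shows "u * u = - 1"
proof -
  have "u * u + 1 = 0"
    using assms by (simp add: quat_eq_iff qsqnorm_def power2_eq_square)
  then show ?thesis
    by (simp add: eq_neg_iff_add_eq_0)
qed

text \<open>The span of 1 and u is a copy of the complex numbers with u in the role of i, so powers
  can be computed there.\<close>

lemma imaginary_unit_power:
  fixes u :: "'a::real_algebra_1"
  assumes "u * u = - 1"
  shows "(Re z *\<^sub>R 1 + Im z *\<^sub>R u) ^ k = Re (z ^ k) *\<^sub>R 1 + Im (z ^ k) *\<^sub>R u"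
proof (induction k)
  case (Suc k)
  have "(Re z *\<^sub>R 1 + Im z *\<^sub>R u) ^ Suc k =
      (Re z *\<^sub>R 1 + Im z *\<^sub>R u) * (Re (z ^ k) *\<^sub>R 1 + Im (z ^ k) *\<^sub>R u)"
    using Suc by simp
  also have "\<dots> = Re (z ^ Suc k) *\<^sub>R 1 + Im (z ^ Suc k) *\<^sub>R u"
    by (simp add: algebra_simps assms)
  finally show ?case .
qed simp

text \<open>For d nonzero the equation forces u to be minus c times the inverse of d; orthogonality
  makes this u purely imaginary and the equal norms give it norm 1. For d = 0 also c = 0, and any
  imaginary unit will do.\<close>

lemma quat_imaginary_unit_solution:
  assumes norms: "qsqnorm c = qsqnorm d"
    and orth: "qre c * qre d + qi c * qi d + qj c * qj d + qk c * qk d = 0"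
  shows "\<exists>u. qre u = 0 \<and> qsqnorm u = 1 \<and> c + u * d = 0"
proof (cases "d = 0")
  case True
  then have "c = 0"
    using norms by (simp add: qsqnorm_def flip: qsqnorm_eq_0_iff)
  with True show ?thesis
    by (intro exI[of _ "Quat 0 1 0 0"]) (simp add: qsqnorm_def)
next
  case False
  then have ne: "qsqnorm d \<noteq> 0"
    by simp
  \<comment> \<open>The inverse of d is \<open>qcnj d\<close> divided by
    \<open>qsqnorm d\<close>.\<close>
  define u where "u = (- 1 / qsqnorm d) *\<^sub>R (c * qcnj d)"
  have "qre u = 0"
    using orth by (simp add: u_def algebra_simps)
  moreover have "qsqnorm u = 1"
  proof -
    have "qsqnorm u = (- 1 / qsqnorm d)\<^sup>2 * (qsqnorm d * qsqnorm d)"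
      unfolding u_def qsqnorm_scaleR qsqnorm_mult using norms by simp
    then show ?thesis
      using ne by (simp add: power2_eq_square)
  qed
  moreover have "c + u * d = 0"
    using ne by (simp add: u_def mult.assoc qcnj_mult_self)
  ultimately show ?thesis
    by blast
qed


section \<open>Quaternionic polynomials\<close>

lemma lookup_times_nat:
  fixes P Q :: "nat \<Rightarrow>\<^sub>0 'a::semiring_0"
  shows "Poly_Mapping.lookup (P * Q) n =
    (\<Sum>i\<le>n. Poly_Mapping.lookup P i * Poly_Mapping.lookup Q (n - i))"
proof -
  have *: "(\<Sum>q. Poly_Mapping.lookup Q q when n = i + q) =
      (Poly_Mapping.lookup Q (n - i) when i \<le> n)" for i
  proof -
    have "(\<Sum>q. Poly_Mapping.lookup Q q when n = i + q) =
        (\<Sum>q. (Poly_Mapping.lookup Q (n - i) when i \<le> n) when q = n - i)"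
      by (rule Sum_any.cong) (auto simp: when_def)
    then show ?thesis
      by simp
  qed
  have "Poly_Mapping.lookup (P * Q) n =
      (\<Sum>i. Poly_Mapping.lookup P i * Poly_Mapping.lookup Q (n - i) when i \<le> n)"
    by (simp add: lookup_mult * mult_when)
  also have "\<dots> = (\<Sum>i\<le>n. Poly_Mapping.lookup P i * Poly_Mapping.lookup Q (n - i) when i \<le> n)"
    by (rule Sum_any.expand_superset) auto
  finally show ?thesis
    by simp
qed

lemma lookup_gt_hdegree:
  assumes "hdegree P < k"
  shows "Poly_Mapping.lookup P k = 0"
proof (rule ccontr)
  assume "Poly_Mapping.lookup P k \<noteq> 0"
  then have "k \<in> Poly_Mapping.keys P"
    by (simp add: in_keys_iff)
  then have "k \<le> hdegree P"
    by (auto simp: hdegree_def)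
  with assms show False
    by simp
qed

lemma heval_eq_sum:
  assumes "hdegree P \<le> n"
  shows "heval P x = (\<Sum>k\<le>n. x ^ k * Poly_Mapping.lookup P k)"
  unfolding heval_def
  by (rule sum.mono_neutral_left) (use assms in \<open>auto simp: lookup_gt_hdegree\<close>)

lemma heval_add: "heval (P + Q) x = heval P x + heval Q x"
proof -
  \<comment> \<open>Cancellation can lower the degree of the sum, so all three evaluations are
    rewritten over one common range.\<close>
  define n where "n = Max {hdegree P, hdegree Q, hdegree (P + Q)}"
  have "hdegree P \<le> n" "hdegree Q \<le> n" "hdegree (P + Q) \<le> n"
    by (simp_all add: n_def)
  then show ?thesis
    by (simp add: heval_eq_sum[where n = n] lookup_add distrib_left sum.distrib)
qed

lemma heval_1 [simp]: "heval 1 x = 1"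
  by (simp add: heval_def hdegree_def lookup_one)

lemma lookup_hX_times:
  "Poly_Mapping.lookup (hX * P) k = (if k = 0 then 0 else Poly_Mapping.lookup P (k - 1))"
proof -
  have "Poly_Mapping.lookup (hX * P) k =
      (\<Sum>i\<le>k. if i = 1 then Poly_Mapping.lookup P (k - 1) else 0)"
    unfolding lookup_times_nat
    by (rule sum.cong) (auto simp: hX_def lookup_single when_def)
  then show ?thesis
    by (simp add: Suc_le_eq)
qed

text \<open>Evaluation is not multiplicative over a noncommutative ring. A left factor X is harmless
  because powers of x stand to the left of the coefficients.\<close>

lemma heval_hX_times: "heval (hX * P) x = x * heval P x"
proof -
  define n where "n = max (hdegree P) (hdegree (hX * P))"
  have n: "hdegree P \<le> n" "hdegree (hX * P) \<le> Suc n"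
    by (simp_all add: n_def)
  show ?thesis
    unfolding heval_eq_sum[OF n(1)] heval_eq_sum[OF n(2)]
    by (subst sum.atMost_Suc_shift) (simp add: lookup_hX_times sum_distrib_left mult.assoc)
qed

lemma heval_hX_power_times: "heval (hX ^ n * P) x = x ^ n * heval P x"
  by (induction n) (simp_all add: heval_hX_times mult.assoc)

lemma heval_hX_sq_plus_1_power: "heval ((hX\<^sup>2 + 1) ^ n) x = (x\<^sup>2 + 1) ^ n"
proof (induction n)
  case (Suc n)
  \<comment> \<open>Expanding one factor leaves only sums and left multiplication by powers of X,
    both of which evaluation respects.\<close>
  have "heval ((hX\<^sup>2 + 1) ^ Suc n) x =
      heval (hX\<^sup>2 * (hX\<^sup>2 + 1) ^ n) x + heval ((hX\<^sup>2 + 1) ^ n) x"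
    by (simp add: distrib_right heval_add)
  also have "\<dots> = (x\<^sup>2 + 1) ^ Suc n"
    unfolding heval_hX_power_times Suc by (simp add: distrib_right)
  finally show ?case .
qed simp

section \<open>Coefficients of the normal polynomial\<close>

lemma lookup_hnormal:
  "Poly_Mapping.lookup (hnormal P) n =
    (\<Sum>i\<le>n. Poly_Mapping.lookup P i * qcnj (Poly_Mapping.lookup P (n - i)))"
  by (auto simp: hnormal_def hcnj_def lookup_times_nat map.rep_eq when_def intro!: sum.cong)

text \<open>Conjugation reverses products and hence swaps the summands for i and n - i. The
  coefficient is therefore fixed by conjugation, that is, real.\<close>

lemma lookup_hnormal_real:
  "Poly_Mapping.lookup (hnormal P) n = qre (Poly_Mapping.lookup (hnormal P) n) *\<^sub>R 1"
proof -
  let ?b = "Poly_Mapping.lookup (hnormal P) n"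
  have "qcnj ?b = (\<Sum>i\<le>n. Poly_Mapping.lookup P (n - i) * qcnj (Poly_Mapping.lookup P i))"
    by (simp add: lookup_hnormal qcnj_sum qcnj_mult)
  also have "\<dots> = ?b"
    unfolding lookup_hnormal
    by (rule sum.reindex_bij_witness[where i = "\<lambda>i. n - i" and j = "\<lambda>i. n - i"]) auto
  finally have "qcnj ?b = ?b" .
  then show ?thesis
    unfolding quat_eq_iff by simp
qed


section \<open>Complex roots of the normal polynomial\<close>

definition component_poly :: "(quat \<Rightarrow> real) \<Rightarrow> hpoly \<Rightarrow> complex poly" where
  "component_poly h P =
    (\<Sum>k\<le>hdegree P. monom (of_real (h (Poly_Mapping.lookup P k))) k)"

lemma coeff_component_poly:
  assumes "h 0 = 0"
  shows "coeff (component_poly h P) k = of_real (h (Poly_Mapping.lookup P k))"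
  using assms by (auto simp: component_poly_def coeff_sum lookup_gt_hdegree not_le)

lemma poly_component_poly:
  "poly (component_poly h P) z =
    (\<Sum>k\<le>hdegree P. of_real (h (Poly_Mapping.lookup P k)) * z ^ k)"
  by (simp add: component_poly_def poly_sum poly_monom)

text \<open>\<open>N(P)\<close> over the complex numbers: the sum of the squares of the four component polynomials.\<close>

definition normal_poly :: "hpoly \<Rightarrow> complex poly" where
  "normal_poly P = (component_poly qre P)\<^sup>2 + (component_poly qi P)\<^sup>2
    + (component_poly qj P)\<^sup>2 + (component_poly qk P)\<^sup>2"

text \<open>The real part of \<open>a * qcnj b\<close> is the Euclidean inner product of a and b, so
  the convolution splits into the squares of the four components.\<close>

lemma coeff_normal_poly:
  "coeff (normal_poly P) n = of_real (qre (Poly_Mapping.lookup (hnormal P) n))"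
  by (simp add: normal_poly_def power2_eq_square coeff_mult coeff_component_poly lookup_hnormal
      sum.distrib)

text \<open>Write the sum of the z^k a_k in the complexified quaternions as c + i d. The real and
  imaginary parts of the vanishing sum of four squares say that c and d have equal norms and are
  orthogonal. So c + u d = 0 for some imaginary unit u, and replacing i by u in z turns c + u d into
  a value of P.\<close>

lemma zero_if_poly_normal_poly_eq_0:
  assumes "poly (normal_poly P) z = 0"
  shows "\<exists>x. heval P x = 0 \<and> qre x = Re z"
proof -
  let ?a = "Poly_Mapping.lookup P"
  define c where "c = (\<Sum>k\<le>hdegree P. Re (z ^ k) *\<^sub>R ?a k)"
  define d where "d = (\<Sum>k\<le>hdegree P. Im (z ^ k) *\<^sub>R ?a k)"
  have comp: "poly (component_poly qre P) z = Complex (qre c) (qre d)"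
    "poly (component_poly qi P) z = Complex (qi c) (qi d)"
    "poly (component_poly qj P) z = Complex (qj c) (qj d)"
    "poly (component_poly qk P) z = Complex (qk c) (qk d)"
    by (simp_all add: poly_component_poly c_def d_def complex_eq_iff mult.commute)
  have "qsqnorm c = qsqnorm d"
    "qre c * qre d + qi c * qi d + qj c * qj d + qk c * qk d = 0"
    using assms
    by (simp_all add: normal_poly_def comp complex_eq_iff qsqnorm_def power2_eq_square
        algebra_simps)
  then obtain u where u: "qre u = 0" "qsqnorm u = 1" "c + u * d = 0"
    using quat_imaginary_unit_solution by blast
  let ?x = "Re z *\<^sub>R 1 + Im z *\<^sub>R u"
  have "heval P ?x = c + u * d"
    unfolding heval_def c_def d_def imaginary_unit_power[OF quat_imaginary_unit_sq[OF u(1,2)]]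
    by (simp add: distrib_right sum.distrib sum_distrib_left)
  with u show ?thesis
    by (intro exI[of _ ?x]) simp
qed

lemma poly_normal_poly_of_real_nonneg:
  "Im (poly (normal_poly P) (of_real t)) = 0 \<and> Re (poly (normal_poly P) (of_real t)) \<ge> 0"
proof -
  have "poly (component_poly h P) (of_real t) =
      of_real (\<Sum>k\<le>hdegree P. h (Poly_Mapping.lookup P k) * t ^ k)" for h
    by (simp add: poly_component_poly)
  then show ?thesis
    by (simp add: normal_poly_def flip: of_real_power of_real_add)
qed

text \<open>Dividing out the full power of X leaves a polynomial without roots, which is constant by
  the fundamental theorem of algebra.\<close>

lemma poly_eq_monom_if_only_root_0:
  fixes p :: "complex poly"
  assumes roots: "\<And>z. poly p z = 0 \<Longrightarrow> z = 0"
  shows "\<exists>c n. p = monom c n"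
proof (cases "p = 0")
  case True
  then have "p = monom 0 0"
    by simp
  then show ?thesis
    by blast
next
  case False
  then obtain q where q: "p = [:- 0, 1:] ^ order 0 p * q" "\<not> [:- 0, 1:] dvd q"
    using order_decomp by blast
  have "poly q z \<noteq> 0" for z
  proof
    assume "poly q z = 0"
    moreover from this have "z = 0"
      using roots q(1) by (metis mult_zero_right poly_mult)
    ultimately show False
      using q(2) by (simp add: poly_eq_0_iff_dvd)
  qed
  then have "constant (poly q)"
    using fundamental_theorem_of_algebra by blast
  then obtain c where "q = [:c:]"
    by (auto simp: constant_degree elim: degree_eq_zeroE)
  then have "p = monom c (order 0 p)"
    using q(1) by (simp add: monom_altdef)
  then show ?thesis
    by blast
qed

lemma unique_odd_coeff_imp_imaginary_root_eq_0:
  fixes p :: "complex poly"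
  assumes real: "\<And>n. coeff p n \<in> \<real>"
    and k: "odd k" "coeff p k \<noteq> 0"
    and uniq: "\<And>n. odd n \<Longrightarrow> coeff p n \<noteq> 0 \<Longrightarrow> n = k"
    and z: "poly p z = 0" "Re z = 0"
  shows "z = 0"
proof -
  obtain y where y: "z = \<i> * of_real y"
    using z(2) by (auto simp: complex_eq_iff intro: that[of "Im z"])
  obtain m where m: "k = 2 * m + 1"
    using k(1) by (rule oddE)
  \<comment> \<open>At z = iy the even powers are real, so with real coefficients only the single
    odd term reaches the imaginary part.\<close>
  have Im_summand: "Im (coeff p n * z ^ n) = (if n = k then Re (coeff p k) * (- 1) ^ m * y ^ k else 0)"
    for n
  proof (cases "even n")
    case True
    then obtain j where "n = 2 * j"
      by (rule evenE)
    then have "coeff p n * z ^ n \<in> \<real>"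
      using real[of n] by (simp add: y power_mult_distrib power_mult flip: of_real_power)
    moreover have "n \<noteq> k"
      using True k(1) by blast
    ultimately show ?thesis
      by (simp add: complex_is_Real_iff)
  next
    case False
    show ?thesis
    proof (cases "n = k")
      case True
      have "z ^ k = \<i> * of_real ((- 1) ^ m * y ^ k)"
        by (simp add: y m power_mult_distrib power_mult power_minus[of "_\<^sup>2"])
      then show ?thesis
        using True real[of k] by (simp add: complex_is_Real_iff)
    next
      case ne: False
      then have "coeff p n = 0"
        using uniq[of n] False by blast
      with ne show ?thesis
        by simp
    qed
  qed
  have "k \<le> degree p"
    using k(2) by (rule le_degree)
  have "Im (poly p z) = Re (coeff p k) * (- 1) ^ m * y ^ k"
    using \<open>k \<le> degree p\<close> by (simp add: poly_altdef Im_summand del: times_complex.sel)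
  moreover have "Re (coeff p k) \<noteq> 0"
    using k(2) real[of k] by (simp add: complex_is_Real_iff complex_eq_iff)
  ultimately show ?thesis
    using z(1) y by simp
qed

theorem proposition4:
  fixes P :: hpoly and d e :: nat
  assumes "hdegree P = d" and "d \<ge> 3"
    and "e < d"
    and "hnormal P = hX ^ (2 * e) * (hX ^ 2 + 1) ^ (d - e)"
    and "\<exists>!k. odd k \<and> Poly_Mapping.lookup (hnormal (hderiv P)) k \<noteq> 0"
  shows "\<not> gauss_lucas P"
proof
  assume "gauss_lucas P"
  then have sub: "hzeros (hderiv P) \<subseteq> convex hull (hzeros (hnormal P))"
    by (simp add: gauss_lucas_def)
  have "hzeros (hnormal P) \<subseteq> {x. qre x = 0}"
  proof
    fix x assume "x \<in> hzeros (hnormal P)"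
    then have "x ^ (2 * e) * (x\<^sup>2 + 1) ^ (d - e) = 0"
      by (simp add: hzeros_def assms(4) heval_hX_power_times heval_hX_sq_plus_1_power)
    then have "x = 0 \<or> x\<^sup>2 + 1 = 0"
      by (metis mult_eq_0_iff power_not_zero)
    then show "x \<in> {x. qre x = 0}"
      using quat_sq_plus_1_eq_0 by auto
  qed
  \<comment> \<open>The purely imaginary quaternions form a real subspace, which hence contains the
    hull of any of its subsets.\<close>
  moreover have "convex {x. qre x = 0}"
    by (auto simp: convex_def)
  ultimately have "convex hull (hzeros (hnormal P)) \<subseteq> {x. qre x = 0}"
    by (rule hull_minimal)
  with sub have zeros: "qre x = 0" if "heval (hderiv P) x = 0" for x
    using that by (auto simp: hzeros_def)

  define f where "f = normal_poly (hderiv P)"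
  have coeff_f: "coeff f n = 0 \<longleftrightarrow> Poly_Mapping.lookup (hnormal (hderiv P)) n = 0" for n
    using lookup_hnormal_real[of "hderiv P" n] by (auto simp: f_def coeff_normal_poly)
  obtain k where k: "odd k" "coeff f k \<noteq> 0"
    and uniq: "\<And>n. odd n \<Longrightarrow> coeff f n \<noteq> 0 \<Longrightarrow> n = k"
    using assms(5) unfolding coeff_f by auto
  have "z = 0" if "poly f z = 0" for z
  proof (rule unique_odd_coeff_imp_imaginary_root_eq_0[OF _ k uniq that])
    show "coeff f n \<in> \<real>" for n
      by (simp add: f_def coeff_normal_poly)
    show "Re z = 0"
      using zero_if_poly_normal_poly_eq_0 that zeros unfolding f_def by metis
  qed
  then obtain c n where "f = monom c n"
    using poly_eq_monom_if_only_root_0 by blast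
  \<comment> \<open>A monomial with a nonzero coefficient at k has exponent k.\<close>
  with k have f: "f = monom c k"
    by (auto split: if_splits)
  \<comment> \<open>As k is odd, f takes the values c at 1 and -c at -1, and both are nonnegative
    reals.\<close>
  have "Im c = 0" "Re c \<ge> 0" "Re (- c) \<ge> 0"
    using poly_normal_poly_of_real_nonneg[of "hderiv P" 1]
      poly_normal_poly_of_real_nonneg[of "hderiv P" "- 1"] k(1)
    by (simp_all add: f poly_monom flip: f_def)
  then have "c = 0"
    by (simp add: complex_eq_iff)
  with f k show False
    by simp
qed

end
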